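(* Let $R$ be a nonzero commutative ring with identity that is not an integral domain. Then the following statements are equivalent: (1) $\mathbb{A}(R)^*\subseteq \mathrm{Max}(R)$, i.e. every vertex of $\mathbb{AG}(R)$ is a maximal ideal of $R$. (2) $\mathbb{A}(R)^*=\mathrm{Max}(R)$. (3) $\mathbb{A}(R)^*=\mathrm{Spec}(R)$. (4) $\mathbb{A}(R)^*\subseteq \mathrm{Spec}(R)$. (5) Either $R\cong F_1\oplus F_2$ (direct product of rings), where $F_1,F_2$ are fields, or $R$ has only one nonzero proper ideal.
   Context: An ideal $I$ of a commutative ring $R$ is called an annihilating-ideal if there exists a nonzero ideal $J$ of $R$ with $IJ=(0)$. $\mathbb{A}(R)$ denotes the set of all annihilating-ideals of $R$, and $\mathbb{A}(R)^*=\mathbb{A}(R)\setminus\{(0)\}$. The annihilating-ideal graph $\mathbb{AG}(R)$ is the undirected graph with vertex set $\mathbb{A}(R)^*$ in which two distinct vertices $I,J$ are adjacent if and only if $IJ=(0)$. $\mathrm{Spec}(R)$ and $\mathrm{Max}(R)$ are the sets of prime ideals and of maximal ideals of $R$. "Only one nonzero proper ideal" means exactly one. *)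

theory Defs
  imports "HOL-Algebra.Algebra"
begin

definition annihilating_ideals :: "('a, 'm) ring_scheme \<Rightarrow> 'a set set" where
  "annihilating_ideals R =
     {I. ideal I R \<and> (\<exists>J. ideal J R \<and> J \<noteq> {\<zero>\<^bsub>R\<^esub>} \<and> I \<cdot>\<^bsub>R\<^esub> J = {\<zero>\<^bsub>R\<^esub>})}"

definition nonzero_annihilating_ideals :: "('a, 'm) ring_scheme \<Rightarrow> 'a set set" where
  "nonzero_annihilating_ideals R = annihilating_ideals R - {{\<zero>\<^bsub>R\<^esub>}}"

definition prime_ideals :: "('a, 'm) ring_scheme \<Rightarrow> 'a set set" where
  "prime_ideals R = {P. primeideal P R}"

definition maximal_ideals :: "('a, 'm) ring_scheme \<Rightarrow> 'a set set" where
  "maximal_ideals R = {M. maximalideal M R}"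

text \<open>HOL cannot quantify existentially over types, so the two fields are taken with
  carriers in the type of the ring itself. This loses no generality, by
  \<open>product_of_two_fieldsI\<close> below: a field on any other type that is a factor of
  \<open>R\<close> can be copied to a subset of the carrier of \<open>R\<close>.\<close>

definition product_of_two_fields :: "('a, 'm) ring_scheme \<Rightarrow> bool" where
  "product_of_two_fields R \<longleftrightarrow>
     (\<exists>(F1 :: 'a ring) (F2 :: 'a ring). field F1 \<and> field F2 \<and> R \<simeq> RDirProd F1 F2)"

lemma product_of_two_fieldsI:
  fixes R :: "('a, 'm) ring_scheme"
    and F1 :: "('b, 'n) ring_scheme"
    and F2 :: "('c, 'p) ring_scheme"
  assumes F1: "field F1" and F2: "field F2" and iso: "R \<simeq> RDirProd F1 F2"
  shows "product_of_two_fields R"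
proof -
  interpret F1: field F1 by (rule F1)
  interpret F2: field F2 by (rule F2)
  obtain f where "f \<in> ring_iso R (RDirProd F1 F2)"
    using iso unfolding is_ring_iso_def by blast
  then have f: "f \<in> ring_iso R (RDirProd F1 F2)"
    and bij: "bij_betw f (carrier R) (carrier F1 \<times> carrier F2)"
    by (auto simp: ring_iso_def RDirProd_carrier)
  define h where "h = inv_into (carrier R) f"
  have inj_h: "inj_on h (carrier F1 \<times> carrier F2)"
    using bij_betw_inv_into[OF bij] unfolding h_def bij_betw_def by blast
  define g1 where "g1 = (\<lambda>x. h (x, \<zero>\<^bsub>F2\<^esub>))"
  define g2 where "g2 = (\<lambda>y. h (\<zero>\<^bsub>F1\<^esub>, y))"
  have inj1: "inj_on g1 (carrier F1)" and inj2: "inj_on g2 (carrier F2)"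
    using inj_h unfolding g1_def g2_def inj_on_def
    by (metis F1.zero_closed F2.zero_closed SigmaI prod.inject)+
  have "(\<lambda>(r, s). (g1 r, g2 s)) \<in>
      ring_iso (RDirProd F1 F2) (RDirProd (image_ring g1 F1) (image_ring g2 F2))"
    by (intro RDirProd_iso6 inj_imp_image_ring_iso inj1 inj2)
  then have "R \<simeq> RDirProd (image_ring g1 F1) (image_ring g2 F2)"
    using ring_iso_set_trans[OF f] unfolding is_ring_iso_def by blast
  moreover have "field (image_ring g1 F1)" "field (image_ring g2 F2)"
    using F1.inj_imp_image_ring_is_field[OF inj1] F2.inj_imp_image_ring_is_field[OF inj2] .
  ultimately show ?thesis
    unfolding product_of_two_fields_def by blast
qed

end

theory Submission
  imports Defs
begin

text \<open>If every nonzero annihilating ideal is prime, then so is every nonzero ideal below one.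
  A nonzero \<open>a\<close> with \<open>a\<^sup>2 = 0\<close> lies in every prime ideal; this makes \<open>Ann(a)\<close> equal to the
  ideal generated by \<open>a\<close>, and it is the only nonzero proper ideal. If there is no such \<open>a\<close> and
  \<open>x y = 0\<close> with \<open>x, y\<close> nonzero, then \<open>x\<close> lies in the prime ideal generated by \<open>x\<^sup>2\<close>, say
  \<open>x = r x\<^sup>2\<close>, and \<open>e = r x\<close> is a nontrivial idempotent; primality forces \<open>e\<close> and \<open>1 - e\<close> to
  generate minimal ideals, so \<open>R\<close> is a product of two fields. Conversely, in both cases
  every nonzero proper ideal is annihilating and maximal.\<close>

context cring
begin

section \<open>Annihilating ideals, and rings with a unique nonzero proper ideal\<close>

text \<open>Any nonzero element of the witness \<open>J\<close> can serve as \<open>z\<close>.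
  Conversely, \<open>PIdl z\<close> can serve as \<open>J\<close>, since
  \<open>i \<otimes> (x \<otimes> z) = x \<otimes> (i \<otimes> z)\<close>. All later arguments use
  this elementwise form, so that products of ideals do not appear again.\<close>

lemma nonzero_annihilating_ideals_iff:
  "I \<in> nonzero_annihilating_ideals R \<longleftrightarrow>
     ideal I R \<and> I \<noteq> {\<zero>} \<and> (\<exists>z\<in>carrier R. z \<noteq> \<zero> \<and> (\<forall>i\<in>I. i \<otimes> z = \<zero>))"
proof (intro iffI)
  assume "I \<in> nonzero_annihilating_ideals R"
  then obtain J where I: "ideal I R" "I \<noteq> {\<zero>}" and J: "ideal J R" "J \<noteq> {\<zero>}" "I \<cdot> J = {\<zero>}"
    unfolding nonzero_annihilating_ideals_def annihilating_ideals_def by blast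
  have "\<zero> \<in> J"
    using J(1) by (simp add: additive_subgroup.zero_closed ideal.axioms(1))
  then obtain z where "z \<in> J" "z \<noteq> \<zero>" using J(2) by blast
  then have "z \<in> carrier R" "\<forall>i\<in>I. i \<otimes> z = \<zero>"
    using J(1,3) ideal.Icarr[of J R z] ideal_prod.prod[of _ I z J R] by auto
  with I \<open>z \<noteq> \<zero>\<close>
  show "ideal I R \<and> I \<noteq> {\<zero>} \<and> (\<exists>z\<in>carrier R. z \<noteq> \<zero> \<and> (\<forall>i\<in>I. i \<otimes> z = \<zero>))" by blast
next
  assume "ideal I R \<and> I \<noteq> {\<zero>} \<and> (\<exists>z\<in>carrier R. z \<noteq> \<zero> \<and> (\<forall>i\<in>I. i \<otimes> z = \<zero>))"
  then obtain z where I: "ideal I R" "I \<noteq> {\<zero>}"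
    and z: "z \<in> carrier R" "z \<noteq> \<zero>" "\<And>i. i \<in> I \<Longrightarrow> i \<otimes> z = \<zero>" by blast
  have J: "ideal (PIdl z) R" "PIdl z \<noteq> {\<zero>}"
    using cgenideal_ideal cgenideal_self z by blast+
  have "s = \<zero>" if "s \<in> I \<cdot> (PIdl z)" for s
    using that
  proof induct
    case (prod i j)
    then obtain x where x: "x \<in> carrier R" "j = x \<otimes> z"
      unfolding cgenideal_def by blast
    have "i \<in> carrier R" using prod(1) I(1) ideal.Icarr by metis
    then have "i \<otimes> j = x \<otimes> (i \<otimes> z)" using x z(1) by (simp add: m_lcomm)
    then show ?case using z(3)[OF prod(1)] x by simp
  qed simp
  moreover have "\<zero> \<in> I \<cdot> (PIdl z)"
    using ideal_prod_is_ideal[OF I(1) J(1)] by (simp add: additive_subgroup.zero_closed ideal.axioms(1))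
  ultimately have "I \<cdot> (PIdl z) = {\<zero>}" by blast
  then show "I \<in> nonzero_annihilating_ideals R"
    using I J unfolding nonzero_annihilating_ideals_def annihilating_ideals_def by blast
qed

lemma nonzero_annihilating_ideal_proper:
  assumes "I \<in> nonzero_annihilating_ideals R" shows "I \<noteq> carrier R"
  using assms nonzero_annihilating_ideals_iff by (metis l_one one_closed)

lemma not_domainE:
  assumes "carrier R \<noteq> {\<zero>}" "\<not> domain R"
  obtains x y where "x \<in> carrier R" "y \<in> carrier R" "x \<noteq> \<zero>" "y \<noteq> \<zero>" "x \<otimes> y = \<zero>"
proof -
  have "\<one> \<noteq> \<zero>" using assms(1) carrier_one_zero by blast
  then show thesis using assms(2) that domainI[OF is_cring] by blast
qed

text \<open>Reduces both equalities to a check on each nonzero proper ideal. Since \<open>R\<close>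
  is not a domain, the zero ideal is not prime, so every prime ideal is annihilating. The cycle
  primes, annihilating, maximal, primes of inclusions then closes.\<close>

lemma annihilating_maximal_imp_sets_eq:
  assumes nd: "\<not> domain R"
    and all: "\<And>I. ideal I R \<Longrightarrow> I \<noteq> {\<zero>} \<Longrightarrow> I \<noteq> carrier R \<Longrightarrow>
                I \<in> nonzero_annihilating_ideals R \<and> maximalideal I R"
  shows "nonzero_annihilating_ideals R = maximal_ideals R"
    and "nonzero_annihilating_ideals R = prime_ideals R"
proof -
  have mp: "maximal_ideals R \<subseteq> prime_ideals R"
    unfolding maximal_ideals_def prime_ideals_def using maximalideal_prime by blast
  have am: "nonzero_annihilating_ideals R \<subseteq> maximal_ideals R"
    using all nonzero_annihilating_ideal_proper nonzero_annihilating_ideals_iff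
    unfolding maximal_ideals_def by blast
  have pa: "prime_ideals R \<subseteq> nonzero_annihilating_ideals R"
  proof
    fix P assume "P \<in> prime_ideals R"
    then have P: "primeideal P R" unfolding prime_ideals_def by simp
    then have "P \<noteq> {\<zero>}" using nd zeroprimeideal_domainI by blast
    then show "P \<in> nonzero_annihilating_ideals R"
      using all[of P] P primeideal.I_notcarr[OF P] primeideal.axioms(1) by blast
  qed
  show "nonzero_annihilating_ideals R = maximal_ideals R"
    and "nonzero_annihilating_ideals R = prime_ideals R"
    using mp am pa by blast+
qed

text \<open>A nonzero zero divisor \<open>x\<close> generates a nonzero annihilating ideal. That
  ideal is proper, so it is the unique one. Maximality follows because no other ideal is left to lie
  above it.\<close>

lemma unique_ideal_imp_annihilating_maximal:
  assumes nz: "carrier R \<noteq> {\<zero>}" and nd: "\<not> domain R"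
    and uniq: "\<exists>!I. ideal I R \<and> I \<noteq> {\<zero>} \<and> I \<noteq> carrier R"
    and I: "ideal I R" "I \<noteq> {\<zero>}" "I \<noteq> carrier R"
  shows "I \<in> nonzero_annihilating_ideals R \<and> maximalideal I R"
proof
  obtain x y where xy: "x \<in> carrier R" "y \<in> carrier R" "x \<noteq> \<zero>" "y \<noteq> \<zero>" "x \<otimes> y = \<zero>"
    using not_domainE[OF nz nd] .
  have "i \<otimes> y = \<zero>" if "i \<in> PIdl x" for i
    using that xy by (auto simp: cgenideal_def m_assoc)
  then have ann: "PIdl x \<in> nonzero_annihilating_ideals R"
    using xy cgenideal_ideal cgenideal_self nonzero_annihilating_ideals_iff by blast
  then have "PIdl x = I"
    using uniq I nonzero_annihilating_ideals_iff[THEN iffD1, OF ann]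
      nonzero_annihilating_ideal_proper[OF ann] by metis
  then show "I \<in> nonzero_annihilating_ideals R" using ann by simp
  show "maximalideal I R"
  proof (rule maximalidealI)
    fix J assume J: "ideal J R" "I \<subseteq> J" "J \<subseteq> carrier R"
    then have "J \<noteq> {\<zero>}"
      using I(1,2) additive_subgroup.zero_closed ideal.axioms(1) by fastforce
    then show "J = I \<or> J = carrier R" using uniq I J(1) by metis
  qed (use I in auto)
qed

section \<open>Pairs of idempotents generating minimal ideals\<close>

text \<open>The internal form of a decomposition into two fields: complementary orthogonal
  idempotents such that \<open>PIdl e\<close> and \<open>PIdl f\<close> are minimal ideals. Ideals
  can thus be studied inside \<open>R\<close>, without a product ring.\<close>

definition field_split :: "'a \<Rightarrow> 'a \<Rightarrow> bool" where
  "field_split e f \<longleftrightarrow> e \<in> carrier R \<and> f \<in> carrier R \<and> e \<noteq> \<zero> \<and> f \<noteq> \<zero> \<and>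
     e \<oplus> f = \<one> \<and> e \<otimes> f = \<zero> \<and>
     (\<forall>z\<in>carrier R. e \<otimes> z \<noteq> \<zero> \<longrightarrow> e \<in> PIdl (e \<otimes> z)) \<and>
     (\<forall>z\<in>carrier R. f \<otimes> z \<noteq> \<zero> \<longrightarrow> f \<in> PIdl (f \<otimes> z))"

lemma field_split_commute: "field_split e f \<Longrightarrow> field_split f e"
  unfolding field_split_def by (auto simp: a_comm m_comm)

text \<open>The component \<open>e \<otimes> z\<close> lies in \<open>I\<close>, and by minimality
  it already generates \<open>e\<close>.\<close>

lemma field_split_mem_ideal:
  assumes "field_split e f" "ideal I R" "z \<in> I" "e \<otimes> z \<noteq> \<zero>"
  shows "e \<in> I"
proof -
  have "e \<in> carrier R" "z \<in> carrier R" "e \<otimes> z \<in> I"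
    using assms ideal.Icarr ideal.I_l_closed unfolding field_split_def by metis+
  then show ?thesis
    using assms cgenideal_minimal[of I "e \<otimes> z"] unfolding field_split_def by blast
qed

lemma field_split_decompose:
  assumes "field_split e f" "z \<in> carrier R"
  shows "z = e \<otimes> z \<oplus> f \<otimes> z"
  using assms unfolding field_split_def by (metis l_distr l_one)

text \<open>A proper ideal containing \<open>e\<close> has no element with a nonzero
  \<open>f\<close>-component, since that would bring in \<open>f\<close> and hence
  \<open>\<one>\<close>. So \<open>f\<close> kills \<open>I\<close>. Applied to a proper
  \<open>J\<close> above \<open>I\<close>, the same argument shows that each \<open>z\<close> in
  \<open>J\<close> equals \<open>e \<otimes> z\<close> and lies in \<open>I\<close>.\<close>

lemma field_split_annihilating_maximal_aux:
  assumes ef: "field_split e f" and I: "ideal I R" "I \<noteq> carrier R" and e: "e \<in> I"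
  shows "I \<in> nonzero_annihilating_ideals R \<and> maximalideal I R"
proof
  interpret I: ideal I R by (rule I(1))
  have c: "e \<in> carrier R" "f \<in> carrier R" "e \<noteq> \<zero>" "f \<noteq> \<zero>" "e \<oplus> f = \<one>"
    using ef unfolding field_split_def by auto
  have mem_one: "J = carrier R" if "ideal J R" "e \<in> J" "f \<in> J" for J
    using that c(5) additive_subgroup.a_closed[OF ideal.axioms(1)[OF that(1)], of e f]
      ideal.one_imp_carrier by metis
  have "i \<otimes> f = \<zero>" if "i \<in> I" for i
    using field_split_mem_ideal[OF field_split_commute[OF ef] I(1) that] mem_one[OF I(1) e] I(2)
      I.Icarr[OF that] c(2) m_comm by metis
  then show "I \<in> nonzero_annihilating_ideals R"
    using nonzero_annihilating_ideals_iff I(1) e c by blast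
  show "maximalideal I R"
  proof (rule maximalidealI)
    fix J assume J: "ideal J R" "I \<subseteq> J" "J \<subseteq> carrier R"
    show "J = I \<or> J = carrier R"
    proof (rule disjCI)
      assume "J \<noteq> carrier R"
      have "z \<in> I" if z: "z \<in> J" for z
      proof -
        have zc: "z \<in> carrier R" using z J(3) by blast
        have "f \<otimes> z = \<zero>"
          using field_split_mem_ideal[OF field_split_commute[OF ef] J(1) z] mem_one[OF J(1)]
            J(2) e \<open>J \<noteq> carrier R\<close> by blast
        then have "z = e \<otimes> z"
          using field_split_decompose[OF ef zc] zc c(1) by simp
        then show ?thesis using I.I_r_closed[OF e zc] by simp
      qed
      then show "J = I" using J(2) by blast
    qed
  qed (use I in auto)
qed

text \<open>A nonzero element of \<open>I\<close> has a nonzero component, which puts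
  \<open>e\<close> or \<open>f\<close> into \<open>I\<close>. By symmetry both cases are the
  previous lemma.\<close>

lemma field_split_annihilating_maximal:
  assumes ef: "field_split e f" and I: "ideal I R" "I \<noteq> {\<zero>}" "I \<noteq> carrier R"
  shows "I \<in> nonzero_annihilating_ideals R \<and> maximalideal I R"
proof -
  obtain z where z: "z \<in> I" "z \<noteq> \<zero>"
    using I(1,2) additive_subgroup.zero_closed ideal.axioms(1) by blast
  then have "z = e \<otimes> z \<oplus> f \<otimes> z"
    using field_split_decompose[OF ef] ideal.Icarr[OF I(1)] by blast
  then have "e \<otimes> z \<noteq> \<zero> \<or> f \<otimes> z \<noteq> \<zero>" using z(2) by auto
  then have "e \<in> I \<or> f \<in> I"
    using field_split_mem_ideal[OF _ I(1) z(1)] ef field_split_commute by blast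
  then show ?thesis
    using field_split_annihilating_maximal_aux ef field_split_commute I by blast
qed

text \<open>Makes the quotient by \<open>PIdl e\<close> a field. The ideal is proper because
  \<open>f\<close> kills it but does not kill \<open>\<one>\<close>.\<close>

lemma field_split_maximalideal:
  assumes ef: "field_split e f" shows "maximalideal (PIdl e) R"
proof -
  have c: "e \<in> carrier R" "f \<in> carrier R" "e \<noteq> \<zero>" "f \<noteq> \<zero>" "e \<otimes> f = \<zero>"
    using ef unfolding field_split_def by auto
  have "i \<otimes> f = \<zero>" if "i \<in> PIdl e" for i
    using that c by (auto simp: cgenideal_def m_assoc)
  then have "PIdl e \<noteq> carrier R" using c by (metis l_one one_closed)
  then show ?thesis
    using field_split_annihilating_maximal_aux[OF ef cgenideal_ideal _ cgenideal_self] c by blast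
qed

section \<open>Such pairs and products of two fields\<close>

text \<open>The Chinese remainder theorem for \<open>PIdl e\<close> and \<open>PIdl f\<close>, which
  are comaximal and meet in zero.\<close>

lemma field_split_imp_product_of_two_fields:
  assumes ef: "field_split e f" shows "product_of_two_fields R"
proof -
  have c: "e \<in> carrier R" "f \<in> carrier R" "e \<oplus> f = \<one>" "e \<otimes> f = \<zero>"
    using ef unfolding field_split_def by auto
  have I: "ideal (PIdl e) R" and J: "ideal (PIdl f) R"
    using c cgenideal_ideal by auto
  have "\<one> \<in> PIdl e <+> PIdl f"
    using c cgenideal_self unfolding set_add_def' by blast
  then have sum: "PIdl e <+> PIdl f = carrier R"
    using add_ideals[OF I J] ideal.one_imp_carrier by blast
  have "z = \<zero>" if z: "z \<in> PIdl e \<inter> PIdl f" for z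
  proof -
    obtain s t where s: "s \<in> carrier R" "z = s \<otimes> e" and t: "t \<in> carrier R" "z = t \<otimes> f"
      using z unfolding cgenideal_def by blast
    \<comment> \<open>Writing \<open>z\<close> as a multiple of \<open>f\<close> kills its
      \<open>e\<close>-component, and writing it as a multiple of \<open>e\<close> kills its
      \<open>f\<close>-component.\<close>
    have "e \<otimes> z = t \<otimes> (e \<otimes> f)" using t c m_lcomm[of e t f] by simp
    moreover have "f \<otimes> z = s \<otimes> (e \<otimes> f)" using s c m_lcomm[of f s e] m_comm[of f e] by simp
    ultimately show ?thesis
      using field_split_decompose[OF ef, of z] s t c by simp
  qed
  then have "PIdl e \<inter> PIdl f = {\<zero>}"
    using I J additive_subgroup.zero_closed ideal.axioms(1) by blast
  then have "R Quot {\<zero>} \<simeq> RDirProd (R Quot (PIdl e)) (R Quot (PIdl f))"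
    using chinese_remainder_simple[OF I J sum] by simp
  moreover have "R \<simeq> R Quot {\<zero>}"
    by (rule FactRing_zeroideal(2))
  ultimately have "R \<simeq> RDirProd (R Quot (PIdl e)) (R Quot (PIdl f))"
    using ring_iso_trans by blast
  \<comment> \<open>The quotient fields consist of cosets, so they are transported to the element
    type of \<open>R\<close>.\<close>
  then show ?thesis
    by (rule product_of_two_fieldsI[rotated 2])
      (intro maximalideal.quotient_is_field is_cring field_split_maximalideal[OF ef]
        field_split_maximalideal[OF field_split_commute[OF ef]])+
qed

text \<open>The preimages of \<open>(1, 0)\<close> and \<open>(0, 1)\<close> form the pair;
  minimality comes from inverting a nonzero coordinate.\<close>

lemma product_of_two_fields_imp_field_split:
  assumes "product_of_two_fields R"
  obtains e f where "field_split e f"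
proof -
  obtain F1 F2 :: "'a ring" and h where F1: "field F1" and F2: "field F2"
    and h: "h \<in> ring_iso R (RDirProd F1 F2)"
    using assms unfolding product_of_two_fields_def is_ring_iso_def by blast
  interpret F1: field F1 by (rule F1)
  interpret F2: field F2 by (rule F2)
  have bij: "bij_betw h (carrier R) (carrier F1 \<times> carrier F2)"
    using ring_iso_memE(5)[OF h] by (simp add: RDirProd_carrier)
  have inj: "\<And>x y. x \<in> carrier R \<Longrightarrow> y \<in> carrier R \<Longrightarrow> h x = h y \<Longrightarrow> x = y"
    using bij unfolding bij_betw_def inj_on_def by blast
  have surj: "\<exists>x\<in>carrier R. h x = (a, b)" if "a \<in> carrier F1" "b \<in> carrier F2" for a b
  proof -
    have "(a, b) \<in> h ` carrier R" using bij that unfolding bij_betw_def by simp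
    then show ?thesis by auto
  qed
  have closed: "\<exists>a\<in>carrier F1. \<exists>b\<in>carrier F2. h x = (a, b)" if "x \<in> carrier R" for x
    using bij_betwE[OF bij] that by auto
  have mult: "h (x \<otimes> y) = (fst (h x) \<otimes>\<^bsub>F1\<^esub> fst (h y), snd (h x) \<otimes>\<^bsub>F2\<^esub> snd (h y))"
    if "x \<in> carrier R" "y \<in> carrier R" for x y
    using ring_iso_memE(2)[OF h that]
    by (cases "h x"; cases "h y") (simp add: RDirProd_def DirProd_def monoid.defs)
  have add: "h (x \<oplus> y) = (fst (h x) \<oplus>\<^bsub>F1\<^esub> fst (h y), snd (h x) \<oplus>\<^bsub>F2\<^esub> snd (h y))"
    if "x \<in> carrier R" "y \<in> carrier R" for x y
    using ring_iso_memE(3)[OF h that]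
    by (cases "h x"; cases "h y") (simp add: RDirProd_def DirProd_def monoid.defs)
  have one: "h \<one> = (\<one>\<^bsub>F1\<^esub>, \<one>\<^bsub>F2\<^esub>)"
    using ring_iso_memE(4)[OF h] by (simp add: RDirProd_def DirProd_def monoid.defs)
  have zero: "h \<zero> = (\<zero>\<^bsub>F1\<^esub>, \<zero>\<^bsub>F2\<^esub>)"
  proof -
    obtain x where x: "x \<in> carrier R" "h x = (\<zero>\<^bsub>F1\<^esub>, \<zero>\<^bsub>F2\<^esub>)"
      using surj by blast
    \<comment> \<open>Preservation of zero comes from multiplicativity: the image of
      \<open>x \<otimes> \<zero> = \<zero>\<close> is a multiple of the zero pair
      \<open>h x\<close>.\<close>
    have "h (x \<otimes> \<zero>) = (\<zero>\<^bsub>F1\<^esub>, \<zero>\<^bsub>F2\<^esub>)"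
      using mult[OF x(1), of \<zero>] x closed[of \<zero>] by auto
    then show ?thesis using x by simp
  qed
  obtain e where e: "e \<in> carrier R" "h e = (\<one>\<^bsub>F1\<^esub>, \<zero>\<^bsub>F2\<^esub>)" using surj by blast
  obtain f where f: "f \<in> carrier R" "h f = (\<zero>\<^bsub>F1\<^esub>, \<one>\<^bsub>F2\<^esub>)" using surj by blast
  have "e \<in> PIdl (e \<otimes> z)" if z: "z \<in> carrier R" "e \<otimes> z \<noteq> \<zero>" for z
  proof -
    obtain a b where ab: "a \<in> carrier F1" "b \<in> carrier F2" "h z = (a, b)" using closed z by blast
    have hz: "h (e \<otimes> z) = (a, \<zero>\<^bsub>F2\<^esub>)" using mult e z ab by simp
    then have "a \<noteq> \<zero>\<^bsub>F1\<^esub>" using z e zero inj[of "e \<otimes> z" \<zero>] by auto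
    then have u: "a \<in> Units F1" using ab F1.field_Units by blast
    \<comment> \<open>Multiplication by \<open>r\<close> undoes the first coordinate
      \<open>a\<close> of \<open>h (e \<otimes> z)\<close>. The second coordinate of
      \<open>h r\<close> is arbitrary, because it meets a zero.\<close>
    obtain r where r: "r \<in> carrier R" "h r = (inv\<^bsub>F1\<^esub> a, \<zero>\<^bsub>F2\<^esub>)" using surj u by blast
    have "h (r \<otimes> (e \<otimes> z)) = h e" using mult r e z hz u by simp
    then have "e = r \<otimes> (e \<otimes> z)" using inj e r z by (metis m_closed)
    then show ?thesis using r unfolding cgenideal_def by blast
  qed
  moreover have "f \<in> PIdl (f \<otimes> z)" if z: "z \<in> carrier R" "f \<otimes> z \<noteq> \<zero>" for z
  proof -
    obtain a b where ab: "a \<in> carrier F1" "b \<in> carrier F2" "h z = (a, b)" using closed z by blast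
    have hz: "h (f \<otimes> z) = (\<zero>\<^bsub>F1\<^esub>, b)" using mult f z ab by simp
    then have "b \<noteq> \<zero>\<^bsub>F2\<^esub>" using z f zero inj[of "f \<otimes> z" \<zero>] by auto
    then have u: "b \<in> Units F2" using ab F2.field_Units by blast
    obtain r where r: "r \<in> carrier R" "h r = (\<zero>\<^bsub>F1\<^esub>, inv\<^bsub>F2\<^esub> b)" using surj u by blast
    have "h (r \<otimes> (f \<otimes> z)) = h f" using mult r f z hz u by simp
    then have "f = r \<otimes> (f \<otimes> z)" using inj f r z by (metis m_closed)
    then show ?thesis using r unfolding cgenideal_def by blast
  qed
  moreover have "e \<noteq> \<zero>" "f \<noteq> \<zero>" using e f zero by auto
  moreover have "e \<oplus> f = \<one>" using inj[of "e \<oplus> f" \<one>] add e f one by simp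
  moreover have "e \<otimes> f = \<zero>" using inj[of "e \<otimes> f" \<zero>] mult e f zero by simp
  ultimately show thesis using that e f unfolding field_split_def by blast
qed

section \<open>Rings whose nonzero annihilating ideals are prime\<close>

text \<open>A nonzero ideal killed by \<open>a\<close> is prime, and every prime ideal contains the
  square-zero \<open>a\<close>. Playing these two facts against each other determines all
  ideals.\<close>

lemma square_zero_imp_unique_ideal:
  assumes prime: "nonzero_annihilating_ideals R \<subseteq> prime_ideals R"
    and a: "a \<in> carrier R" "a \<noteq> \<zero>" "a \<otimes> a = \<zero>"
  shows "\<exists>!I. ideal I R \<and> I \<noteq> {\<zero>} \<and> I \<noteq> carrier R"
proof -
  have dvd_prime: "b \<in> P" if "primeideal P R" "b \<in> carrier R" "b \<otimes> b = \<zero>" for P b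
  proof -
    interpret P: primeideal P R by (rule that(1))
    show ?thesis using P.I_prime that P.zero_closed by metis
  qed
  have killed: "primeideal I R" if "ideal I R" "I \<noteq> {\<zero>}" "\<And>i. i \<in> I \<Longrightarrow> i \<otimes> a = \<zero>" for I
    using that a prime nonzero_annihilating_ideals_iff unfolding prime_ideals_def by blast
  have PIdl_killed: "i \<otimes> a = \<zero>" if "i \<in> PIdl x" "x \<in> carrier R" "x \<otimes> a = \<zero>" for i x
    using that a by (auto simp: cgenideal_def m_assoc)
  have PIdl_prime: "primeideal (PIdl x) R" if "x \<in> carrier R" "x \<noteq> \<zero>" "x \<otimes> a = \<zero>" for x
    using killed cgenideal_ideal cgenideal_self PIdl_killed that by blast
  have Pa: "primeideal (PIdl a) R" using PIdl_prime a by blast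
  interpret Pa: primeideal "PIdl a" R by (rule Pa)
  have ann: "b \<in> PIdl a" if b: "b \<in> carrier R" "b \<otimes> a = \<zero>" for b
  proof (cases "b \<otimes> b = \<zero>")
    case True then show ?thesis using dvd_prime Pa b by blast
  next
    case False
    \<comment> \<open>\<open>PIdl (b \<otimes> b)\<close> is nonzero and killed by \<open>a\<close>,
      hence prime, hence contains \<open>a\<close>. Primality of \<open>PIdl a\<close> is then
      applied to \<open>a = r \<otimes> (b \<otimes> b)\<close>.\<close>
    have "b \<otimes> b \<otimes> a = \<zero>" using b a m_assoc by simp
    then have "a \<in> PIdl (b \<otimes> b)" using PIdl_prime[of "b \<otimes> b"] False b a dvd_prime by simp
    then obtain r where r: "r \<in> carrier R" "a = r \<otimes> (b \<otimes> b)" unfolding cgenideal_def by blast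
    have "r \<otimes> (b \<otimes> b) \<in> PIdl a" using r cgenideal_self a by metis
    then consider "r \<in> PIdl a" | "b \<in> PIdl a" using Pa.I_prime r b by (metis m_closed)
    then show ?thesis
    proof cases
      case 1
      \<comment> \<open>This case is impossible: it would give
        \<open>a = s \<otimes> ((b \<otimes> a) \<otimes> b) = \<zero>\<close>.\<close>
      then obtain s where s: "s \<in> carrier R" "r = s \<otimes> a" unfolding cgenideal_def by blast
      have "r \<otimes> (b \<otimes> b) = s \<otimes> ((b \<otimes> a) \<otimes> b)"
        unfolding s(2) using s(1) a(1) b(1) by (simp add: m_ac)
      also have "\<dots> = \<zero>" using b s(1) by simp
      finally show ?thesis using r(2) a(2) by simp
    qed
  qed
  have eq: "I = PIdl a" if I: "ideal I R" "I \<noteq> {\<zero>}" "I \<noteq> carrier R" for I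
  proof
    interpret I: ideal I R by (rule I(1))
    have inA: "i \<otimes> a = \<zero>" if i: "i \<in> I" for i
    proof (rule ccontr)
      assume ia: "i \<otimes> a \<noteq> \<zero>"
      have ic: "i \<in> carrier R" using i by (rule I.Icarr)
      \<comment> \<open>\<open>PIdl (i \<otimes> a)\<close> is also nonzero and killed by
        \<open>a\<close>, so \<open>a\<close> is a multiple of \<open>i \<otimes> a\<close>.\<close>
      have "i \<otimes> a \<otimes> a = \<zero>" using ic a m_assoc by simp
      then have "a \<in> PIdl (i \<otimes> a)" using PIdl_prime[of "i \<otimes> a"] ia ic a dvd_prime by simp
      then obtain r where r: "r \<in> carrier R" "a = r \<otimes> (i \<otimes> a)" unfolding cgenideal_def by blast
      \<comment> \<open>From \<open>a = r \<otimes> (i \<otimes> a)\<close> it follows that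
        \<open>m\<close> kills \<open>a\<close>. So \<open>m\<close> is a multiple of
        \<open>a\<close> and has square zero.\<close>
      define m where "m = \<one> \<ominus> r \<otimes> i"
      have mc: "m \<in> carrier R" unfolding m_def using r(1) ic by simp
      have "m \<otimes> a = a \<ominus> r \<otimes> (i \<otimes> a)" unfolding m_def using r(1) ic a(1) by algebra
      then have "m \<otimes> a = \<zero>" using r(2)[symmetric] a(1) by (simp add: minus_eq r_neg)
      then have "m \<in> PIdl a" using ann mc by blast
      then obtain t where t: "t \<in> carrier R" "m = t \<otimes> a" unfolding cgenideal_def by blast
      have "m \<otimes> m = (t \<otimes> t) \<otimes> (a \<otimes> a)" using t a(1) by (simp add: m_ac)
      then have mm: "m \<otimes> m = \<zero>" using a t by simp
      \<comment> \<open>\<open>1 - m = r i\<close> is a unit because \<open>m\<^sup>2 = 0\<close>\<close>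
      have "((\<one> \<oplus> m) \<otimes> r) \<otimes> i = (\<one> \<oplus> m) \<otimes> (\<one> \<ominus> m)"
        unfolding m_def using r(1) ic by algebra
      also have "\<dots> = \<one> \<ominus> m \<otimes> m" using mc by algebra
      also have "\<dots> = \<one>" using mm by (simp add: minus_eq)
      finally have "\<one> \<in> I" using I.I_l_closed[OF i, of "(\<one> \<oplus> m) \<otimes> r"] mc r(1) by simp
      then show False using I.one_imp_carrier I(3) by blast
    qed
    show "I \<subseteq> PIdl a" using ann inA I.Icarr by blast
    \<comment> \<open>Being killed by \<open>a\<close>, the ideal \<open>I\<close> is prime and so
      contains \<open>a\<close>.\<close>
    show "PIdl a \<subseteq> I"
      using cgenideal_minimal[OF I(1)] dvd_prime killed[OF I(1,2) inA] a by blast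
  qed
  show ?thesis
  proof (rule ex1I)
    show "ideal (PIdl a) R \<and> PIdl a \<noteq> {\<zero>} \<and> PIdl a \<noteq> carrier R"
      using Pa.is_ideal cgenideal_self[OF a(1)] a(2) Pa.I_notcarr by blast
  qed (use eq in blast)
qed

text \<open>Reducedness enters twice: it makes \<open>x \<otimes> x\<close> nonzero, so that its
  principal ideal is prime, and it keeps \<open>f\<close> out of
  \<open>PIdl (e \<otimes> z)\<close>.\<close>

lemma reduced_imp_field_split:
  assumes nz: "carrier R \<noteq> {\<zero>}" and nd: "\<not> domain R"
    and prime: "nonzero_annihilating_ideals R \<subseteq> prime_ideals R"
    and red: "\<And>a. a \<in> carrier R \<Longrightarrow> a \<otimes> a = \<zero> \<Longrightarrow> a = \<zero>"
  obtains e f where "field_split e f"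
proof -
  obtain x y where xy: "x \<in> carrier R" "y \<in> carrier R" "x \<noteq> \<zero>" "y \<noteq> \<zero>" "x \<otimes> y = \<zero>"
    using not_domainE[OF nz nd] .
  have PIdl_prime: "primeideal (PIdl z) R"
    if "z \<in> carrier R" "z \<noteq> \<zero>" "w \<in> carrier R" "w \<noteq> \<zero>" "z \<otimes> w = \<zero>" for z w
  proof -
    have "i \<otimes> w = \<zero>" if "i \<in> PIdl z" for i
      using that \<open>z \<in> carrier R\<close> \<open>w \<in> carrier R\<close> \<open>z \<otimes> w = \<zero>\<close> by (auto simp: cgenideal_def m_assoc)
    then have "PIdl z \<in> nonzero_annihilating_ideals R"
      using nonzero_annihilating_ideals_iff[of "PIdl z"] that cgenideal_ideal[of z]
        cgenideal_self[of z] by blast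
    then show ?thesis using prime unfolding prime_ideals_def by blast
  qed
  \<comment> \<open>\<open>PIdl (e \<otimes> z)\<close> is nonzero and killed by \<open>f\<close>,
    hence prime, and it contains \<open>e \<otimes> f = \<zero>\<close>. It does not contain
    \<open>f\<close>, since \<open>f = r \<otimes> (e \<otimes> z)\<close> would give \<open>f
    \<otimes> f = (r \<otimes> z) \<otimes> (e \<otimes> f) = \<zero>\<close>.\<close>
  have minimal: "e \<in> PIdl (e \<otimes> z)"
    if e: "e \<in> carrier R" "f \<in> carrier R" "f \<noteq> \<zero>" "e \<oplus> f = \<one>" "e \<otimes> f = \<zero>"
      and z: "z \<in> carrier R" "e \<otimes> z \<noteq> \<zero>" for e f z
  proof -
    have "e \<otimes> z \<otimes> f = z \<otimes> (e \<otimes> f)" using e(1,2) z(1) by (simp add: m_ac)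
    then have "e \<otimes> z \<otimes> f = \<zero>" using e z by simp
    then have "primeideal (PIdl (e \<otimes> z)) R" using PIdl_prime[of "e \<otimes> z" f] e z by simp
    then interpret P: primeideal "PIdl (e \<otimes> z)" R .
    have "e \<otimes> f \<in> PIdl (e \<otimes> z)" using e(5) P.zero_closed by simp
    moreover have "f \<notin> PIdl (e \<otimes> z)"
    proof
      assume "f \<in> PIdl (e \<otimes> z)"
      then obtain r where r: "r \<in> carrier R" "f = r \<otimes> (e \<otimes> z)" unfolding cgenideal_def by blast
      have "f \<otimes> f = (r \<otimes> z) \<otimes> (e \<otimes> f)"
        using e(1,2) z(1) r by (metis m_assoc m_closed m_comm)
      then show False using red[OF e(2)] e r z by simp
    qed
    ultimately show ?thesis using P.I_prime e by blast
  qed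
  have "x \<otimes> x \<noteq> \<zero>" using red xy by blast
  moreover have "x \<otimes> x \<otimes> y = \<zero>" using xy m_assoc by simp
  ultimately have "primeideal (PIdl (x \<otimes> x)) R" using PIdl_prime[of "x \<otimes> x" y] xy by simp
  then interpret P: primeideal "PIdl (x \<otimes> x)" R .
  have "x \<in> PIdl (x \<otimes> x)" using P.I_prime cgenideal_self xy by (metis m_closed)
  then obtain r where r: "r \<in> carrier R" "x = r \<otimes> (x \<otimes> x)" unfolding cgenideal_def by blast
  \<comment> \<open>The relation \<open>x = r \<otimes> (x \<otimes> x)\<close> makes
    \<open>e\<close> idempotent and gives \<open>e \<otimes> x = x\<close>, so \<open>e\<close> is
    nonzero. As \<open>e\<close> kills the nonzero \<open>y\<close>, it is not
    \<open>\<one>\<close>, so \<open>f\<close> is nonzero too.\<close>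
  define e where "e = r \<otimes> x"
  define f where "f = \<one> \<ominus> e"
  have c: "e \<in> carrier R" "f \<in> carrier R" unfolding e_def f_def using r(1) xy(1) by auto
  have "e \<otimes> e = r \<otimes> (r \<otimes> (x \<otimes> x))" unfolding e_def using r(1) xy(1) by (simp add: m_ac)
  then have ee: "e \<otimes> e = e" using r(2)[symmetric] e_def by simp
  have "e \<otimes> x = x" unfolding e_def using r(1) r(2)[symmetric] xy(1) m_assoc by simp
  then have e0: "e \<noteq> \<zero>" using xy by auto
  have ey: "e \<otimes> y = \<zero>" unfolding e_def using r(1) xy m_assoc by simp
  have sum: "e \<oplus> f = \<one>" unfolding f_def using c(1) by algebra
  have f0: "f \<noteq> \<zero>" using sum ey xy c(1) by auto
  have "e \<otimes> f = e \<ominus> e \<otimes> e" unfolding f_def using c(1) by algebra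
  then have ef: "e \<otimes> f = \<zero>" using ee c by (simp add: minus_eq r_neg)
  have "field_split e f"
    unfolding field_split_def
    using c e0 f0 sum ef minimal[of e f] minimal[of f e] a_comm[of e f] m_comm[of e f] by simp
  then show thesis by (rule that)
qed

end

section \<open>The five equivalent conditions\<close>

theorem corollary2p11:
  fixes R (structure)
  assumes "cring R"
    and "carrier R \<noteq> {\<zero>}"
    and "\<not> domain R"
  shows "(nonzero_annihilating_ideals R \<subseteq> maximal_ideals R \<longleftrightarrow>
            nonzero_annihilating_ideals R = maximal_ideals R)
       \<and> (nonzero_annihilating_ideals R = maximal_ideals R \<longleftrightarrow>
            nonzero_annihilating_ideals R = prime_ideals R)
       \<and> (nonzero_annihilating_ideals R = prime_ideals R \<longleftrightarrow>
            nonzero_annihilating_ideals R \<subseteq> prime_ideals R)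
       \<and> (nonzero_annihilating_ideals R \<subseteq> prime_ideals R \<longleftrightarrow>
            product_of_two_fields R \<or>
            (\<exists>!I. ideal I R \<and> I \<noteq> {\<zero>} \<and> I \<noteq> carrier R))"
proof -
  interpret cring R by (rule assms(1))
  let ?A = "nonzero_annihilating_ideals R"
  let ?five = "product_of_two_fields R \<or> (\<exists>!I. ideal I R \<and> I \<noteq> {\<zero>} \<and> I \<noteq> carrier R)"
  have max_prime: "maximal_ideals R \<subseteq> prime_ideals R"
    unfolding maximal_ideals_def prime_ideals_def using maximalideal_prime by blast
  have prime_imp: "?five" if prime: "?A \<subseteq> prime_ideals R"
  proof (cases "\<exists>a\<in>carrier R. a \<noteq> \<zero> \<and> a \<otimes> a = \<zero>")
    case True
    then show ?thesis using square_zero_imp_unique_ideal[OF prime] by blast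
  next
    case False
    then obtain e f where "field_split e f"
      using reduced_imp_field_split[OF assms(2,3) prime] by blast
    then show ?thesis using field_split_imp_product_of_two_fields by blast
  qed
  have imp_eq: "?A = maximal_ideals R \<and> ?A = prime_ideals R" if five: "?five"
  proof -
    have "I \<in> ?A \<and> maximalideal I R" if "ideal I R" "I \<noteq> {\<zero>}" "I \<noteq> carrier R" for I
      using five
    proof
      assume "product_of_two_fields R"
      then obtain e f where "field_split e f" by (rule product_of_two_fields_imp_field_split)
      then show ?thesis using that by (rule field_split_annihilating_maximal)
    next
      assume "\<exists>!I. ideal I R \<and> I \<noteq> {\<zero>} \<and> I \<noteq> carrier R"
      then show ?thesis using that by (rule unique_ideal_imp_annihilating_maximal[OF assms(2,3)])
    qed
    then show ?thesis using annihilating_maximal_imp_sets_eq[OF assms(3)] by simp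
  qed
  \<comment> \<open>Each of the other four conditions is matched with \<open>?five\<close>. Each
    implies the inclusion in the prime ideals, because maximal ideals are prime, and
    \<open>?five\<close> yields both equalities.\<close>
  have "?A \<subseteq> maximal_ideals R \<longleftrightarrow> ?five"
    by (rule iffI, rule prime_imp[OF subset_trans[OF _ max_prime]], assumption,
        rule equalityD1[OF conjunct1[OF imp_eq]])
  moreover have "?A \<subseteq> prime_ideals R \<longleftrightarrow> ?five"
    by (rule iffI, rule prime_imp, assumption, rule equalityD1[OF conjunct2[OF imp_eq]])
  moreover have "?A = maximal_ideals R \<longleftrightarrow> ?five"
    by (rule iffI, rule prime_imp[OF subset_trans[OF equalityD1 max_prime]], assumption,
        rule conjunct1[OF imp_eq])
  moreover have "?A = prime_ideals R \<longleftrightarrow> ?five"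
    by (rule iffI, rule prime_imp[OF equalityD1], assumption, rule conjunct2[OF imp_eq])
  ultimately show ?thesis by (simp only: simp_thms)
qed

end
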